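(* Let $S$ be a finite $\mathrm{GM}$ semigroup generated by a set $X$, with distinguished ideal $I(S)\cong M^0(G,A,B,C)$ and associated transformation semigroup $(G\times B,S)$, and let $\tau$ be the minimal injective congruence (Tilson congruence) on $(G\times B,S)$. Then the following conditions are equivalent: 1. $S_{II}\cap I(S)$ is aperiodic. 2. $\tau$ is a cross-section; that is, for all $g,h\in G$ and $b\in B$, if $(g,b)\,\tau\,(h,b)$ then $g=h$. 3. There is a one-point flow $\Phi:(\{1\},\{1\})\to Rh_B(G)$.
   Context: All semigroups are finite. A semigroup is aperiodic if all its subgroups are trivial. GM semigroups. A semigroup $S$ is $\mathrm{GM}$ (group mapping) if it has a unique $0$-minimal ideal $I(S)$ (if $S$ has no zero, $I(S)$ is its minimal ideal), this ideal is regular, isomorphic to a Rees matrix semigroup $M^0(G,A,B,C)$ (respectively $M(G,A,B,C)$) with $G$ a non-trivial group and $C:B\times A\to G\cup\{0\}$ (product $(a,g,b)(a',g',b')=(a,g\,C(b,a')\,g',b')$), and $S$ acts faithfully by both the right and the left Schützenberger representations on any $\mathcal R$-class, respectively $\mathcal L$-class, contained in $I(S)\setminus\{0\}$. Here the right Schützenberger representation on an $\mathcal R$-class $R$ is the action by partial functions $r\cdot s=rs$ if $rs\in R$, undefined otherwise (dually on the left). Fix an $\mathcal R$-class in $I(S)\setminus\{0\}$ and identify it with $G\times B$; this gives the faithful transformation semigroup $(G\times B,S)$ of partial functions acting on the right. It commutes with the left $G$-action $h(g,b)=(hg,b)$. Type II subsemigroup. $S_{II}$ is the smallest subsemigroup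 of $S$ containing all idempotents and closed under weak conjugation: if $x,y\in S$ and $xyx=x$, then $xS_{II}y\cup yS_{II}x\subseteq S_{II}$. Injective congruences. A congruence on a transformation semigroup $(Q,S)$ is an equivalence relation $\approx$ on $Q$ such that if $q\approx q'$, $s\in S$ and both $qs,q's$ are defined, then $qs\approx q's$. Each $s$ then induces a partial function on $Q/{\approx}$, $[q]s=[q's]$ if $q's$ is defined for some $q'\in[q]$. The congruence is injective if each $s\in S$ induces a partial one-to-one function on $Q/{\approx}$. Intersections of injective congruences are injective, so there is a unique minimal one, denoted $\tau$. Flows. $SP(G\times B)$ is the lattice of pairs $(Y,\Pi)$ with $Y\subseteq G\times B$ and $\Pi$ a partition of $Y$. A subset $Z$ of $G\times B$ is a cross-section if $(g,b),(h,b)\in Z$ implies $g=h$; $(Y,\Pi)$ is a cross-section if every block of $\Pi$ is one. $(Y,\Pi)$ is invariant if $gY=Y$ and $g\Pi=\Pi$ for all $g\in G$. The Rhodes lattice $Rh_B(G)$ is identified with the set $CS(G\times B)$ of invariant cross-sections, together with an extra top element called contradiction. Let $\mathcal A$ be an automaton with state set $Q$ and alphabet $X$ in which each letter acts as a partial function on $Q$. A (complete) flow $f:Q\to Rh_B(G)$ is a function assigning to each $q\in Q$ an invariant cross-section $qf$ such that: (i) for every $(g,b)\in G\times B$ there is $q\in Q$ with $(g,b)\in Y$, where $qf=(Y,\Pi)$; (ii) for $q\in Q$, $x\in X$, with $qf=(Y,\Pi)$ and $(qx)f=(Z,\Theta)$, one has $Yx\subseteq Z$, and for all $y,y'\in Y$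 with $yx,y'x$ both defined, $y,y'$ are in the same $\Pi$-block if and only if $yx,y'x$ are in the same $\Theta$-block; if $qx$ is undefined, condition (ii) is required with $(Z,\Theta)=(\emptyset,\emptyset)$. A one-point flow is a flow from the automaton with a single state on which every letter of $X$ acts as the identity. *)

theory Defs
  imports "HOL-Algebra.Group" "HOL-Library.Disjoint_Sets"
begin

text \<open>The finite semigroup \<open>S\<close> is the whole of a type of sort \<open>{finite, semigroup_mult}\<close>; its
  subsemigroups and ideals are sets. The structure group \<open>G\<close> of a Rees matrix semigroup is a
  \<open>HOL-Algebra\<close> group. Partial functions and adjoined zeros are rendered by \<open>option\<close>, with
  \<open>None\<close> for ``undefined'' and for the zero.\<close>

section \<open>Finite semigroups\<close>

definition is_zero :: "'s::semigroup_mult \<Rightarrow> bool" where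
  "is_zero z \<longleftrightarrow> (\<forall>s. z * s = z \<and> s * z = z)"

definition zeros :: "'s::semigroup_mult set" where
  "zeros = {z. is_zero z}"

definition two_sided_ideal :: "'s::semigroup_mult set \<Rightarrow> bool" where
  "two_sided_ideal J \<longleftrightarrow> J \<noteq> {} \<and> (\<forall>x\<in>J. \<forall>s. x * s \<in> J \<and> s * x \<in> J)"

definition minimal_ideal :: "'s::semigroup_mult set \<Rightarrow> bool" where
  "minimal_ideal J \<longleftrightarrow> two_sided_ideal J \<and> (\<forall>K. two_sided_ideal K \<and> K \<subseteq> J \<longrightarrow> K = J)"

definition zero_minimal_ideal :: "'s::semigroup_mult set \<Rightarrow> bool" where
  "zero_minimal_ideal J \<longleftrightarrow> two_sided_ideal J \<and> J \<noteq> zeros \<and>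
     (\<forall>K. two_sided_ideal K \<and> K \<subseteq> J \<longrightarrow> K = zeros \<or> K = J)"

definition distinguished_ideal :: "'s::semigroup_mult set \<Rightarrow> bool" where
  "distinguished_ideal J \<longleftrightarrow>
     (if (\<exists>z::'s. is_zero z)
      then zero_minimal_ideal J \<and> (\<forall>K. zero_minimal_ideal K \<longrightarrow> K = J)
      else minimal_ideal J)"

definition regular_semigroup :: "'s::semigroup_mult set \<Rightarrow> bool" where
  "regular_semigroup T \<longleftrightarrow> (\<forall>x\<in>T. \<exists>y\<in>T. x * y * x = x)"

definition aperiodic :: "'s::semigroup_mult set \<Rightarrow> bool" where
  "aperiodic T \<longleftrightarrow>
     (\<forall>H e. H \<subseteq> T \<and> group \<lparr>carrier = H, monoid.mult = (*), one = e\<rparr> \<longrightarrow> H = {e})"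

inductive_set subsemigroup_generated :: "'s::semigroup_mult set \<Rightarrow> 's set" for X where
  gen: "x \<in> X \<Longrightarrow> x \<in> subsemigroup_generated X"
| mult: "s \<in> subsemigroup_generated X \<Longrightarrow> t \<in> subsemigroup_generated X
    \<Longrightarrow> s * t \<in> subsemigroup_generated X"

inductive_set type_II :: "'s::semigroup_mult set" where
  idem: "e * e = e \<Longrightarrow> e \<in> type_II"
| mult: "s \<in> type_II \<Longrightarrow> t \<in> type_II \<Longrightarrow> s * t \<in> type_II"
| conj_left: "x * y * x = x \<Longrightarrow> s \<in> type_II \<Longrightarrow> x * s * y \<in> type_II"
| conj_right: "x * y * x = x \<Longrightarrow> s \<in> type_II \<Longrightarrow> y * s * x \<in> type_II"

section \<open>Green's relations and Schuetzenberger representations\<close>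

definition green_R :: "('s::semigroup_mult) rel" where
  "green_R = {(s, t). insert s (range (\<lambda>x. s * x)) = insert t (range (\<lambda>x. t * x))}"

definition green_L :: "('s::semigroup_mult) rel" where
  "green_L = {(s, t). insert s (range (\<lambda>x. x * s)) = insert t (range (\<lambda>x. x * t))}"

definition schutz_right :: "'s::semigroup_mult set \<Rightarrow> 's \<Rightarrow> 's \<Rightarrow> 's option" where
  "schutz_right R r s = (if r * s \<in> R then Some (r * s) else None)"

definition schutz_left :: "'s::semigroup_mult set \<Rightarrow> 's \<Rightarrow> 's \<Rightarrow> 's option" where
  "schutz_left L s l = (if s * l \<in> L then Some (s * l) else None)"

definition schutz_right_faithful :: "'s::semigroup_mult set \<Rightarrow> bool" where
  "schutz_right_faithful R \<longleftrightarrow>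
     (\<forall>s t. (\<forall>r\<in>R. schutz_right R r s = schutz_right R r t) \<longrightarrow> s = t)"

definition schutz_left_faithful :: "'s::semigroup_mult set \<Rightarrow> bool" where
  "schutz_left_faithful L \<longleftrightarrow>
     (\<forall>s t. (\<forall>l\<in>L. schutz_left L s l = schutz_left L t l) \<longrightarrow> s = t)"

section \<open>Rees matrix semigroups and GM semigroups\<close>

text \<open>The flag \<open>z\<close> distinguishes \<open>M\<^sup>0(G,A,B,C)\<close> (with zero \<open>None\<close>) from \<open>M(G,A,B,C)\<close>.\<close>

definition sandwich_matrix ::
  "bool \<Rightarrow> ('g, 'm) monoid_scheme \<Rightarrow> 'a set \<Rightarrow> 'b set \<Rightarrow> ('b \<Rightarrow> 'a \<Rightarrow> 'g option) \<Rightarrow> bool" where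
  "sandwich_matrix z G A B C \<longleftrightarrow>
     (\<forall>b\<in>B. \<forall>a\<in>A. C b a \<in> Some ` carrier G \<union> (if z then {None} else {}))"

definition rees_carrier ::
  "bool \<Rightarrow> ('g, 'm) monoid_scheme \<Rightarrow> 'a set \<Rightarrow> 'b set \<Rightarrow> ('a \<times> 'g \<times> 'b) option set" where
  "rees_carrier z G A B = Some ` (A \<times> carrier G \<times> B) \<union> (if z then {None} else {})"

fun rees_mult ::
  "('g, 'm) monoid_scheme \<Rightarrow> ('b \<Rightarrow> 'a \<Rightarrow> 'g option) \<Rightarrow>
   ('a \<times> 'g \<times> 'b) option \<Rightarrow> ('a \<times> 'g \<times> 'b) option \<Rightarrow> ('a \<times> 'g \<times> 'b) option" where
  "rees_mult G C (Some (a, g, b)) (Some (a', g', b')) =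
     (case C b a' of None \<Rightarrow> None | Some c \<Rightarrow> Some (a, g \<otimes>\<^bsub>G\<^esub> c \<otimes>\<^bsub>G\<^esub> g', b'))"
| "rees_mult G C None y = None"
| "rees_mult G C (Some x) None = None"

definition rees_iso ::
  "bool \<Rightarrow> 's::semigroup_mult set \<Rightarrow> ('g, 'm) monoid_scheme \<Rightarrow> 'a set \<Rightarrow> 'b set \<Rightarrow>
   ('b \<Rightarrow> 'a \<Rightarrow> 'g option) \<Rightarrow> ('s \<Rightarrow> ('a \<times> 'g \<times> 'b) option) \<Rightarrow> bool" where
  "rees_iso z J G A B C \<phi> \<longleftrightarrow>
     bij_betw \<phi> J (rees_carrier z G A B) \<and>
     (\<forall>x\<in>J. \<forall>y\<in>J. \<phi> (x * y) = rees_mult G C (\<phi> x) (\<phi> y))"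

text \<open>The semigroup \<open>'s\<close> is GM, with distinguished ideal \<open>J\<close> and with \<open>\<phi>\<close> an isomorphism of \<open>J\<close>
  onto the given Rees matrix semigroup, which has a zero precisely when \<open>'s\<close> has one.\<close>

definition GM_semigroup ::
  "'s::{finite, semigroup_mult} set \<Rightarrow> ('g, 'm) monoid_scheme \<Rightarrow> 'a set \<Rightarrow> 'b set \<Rightarrow>
   ('b \<Rightarrow> 'a \<Rightarrow> 'g option) \<Rightarrow> ('s \<Rightarrow> ('a \<times> 'g \<times> 'b) option) \<Rightarrow> bool" where
  "GM_semigroup J G A B C \<phi> \<longleftrightarrow>
     distinguished_ideal J \<and> regular_semigroup J \<and>
     group G \<and> carrier G \<noteq> {\<one>\<^bsub>G\<^esub>} \<and>
     sandwich_matrix (\<exists>z::'s. is_zero z) G A B C \<and>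
     rees_iso (\<exists>z::'s. is_zero z) J G A B C \<phi> \<and>
     (\<forall>R \<in> UNIV // green_R. R \<subseteq> J - zeros \<longrightarrow> schutz_right_faithful R) \<and>
     (\<forall>L \<in> UNIV // green_L. L \<subseteq> J - zeros \<longrightarrow> schutz_left_faithful L)"

text \<open>The R-classes in \<open>J - zeros\<close> are the sets with Rees coordinates
  \<open>{a} \<times> G \<times> B\<close> for \<open>a \<in> A\<close>. Fixing \<open>a\<close>, the class is identified with \<open>G \<times> B\<close> through
  \<open>R_class_point\<close>, and \<open>GB_act\<close> is the right Schuetzenberger representation on it.\<close>

definition R_class_point ::
  "'s set \<Rightarrow> ('s \<Rightarrow> ('a \<times> 'g \<times> 'b) option) \<Rightarrow> 'a \<Rightarrow> 'g \<times> 'b \<Rightarrow> 's" where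
  "R_class_point J \<phi> a q = inv_into J \<phi> (Some (a, q))"

definition GB_act ::
  "'s::semigroup_mult set \<Rightarrow> ('g, 'm) monoid_scheme \<Rightarrow> 'b set \<Rightarrow>
   ('s \<Rightarrow> ('a \<times> 'g \<times> 'b) option) \<Rightarrow> 'a \<Rightarrow> 'g \<times> 'b \<Rightarrow> 's \<Rightarrow> ('g \<times> 'b) option" where
  "GB_act J G B \<phi> a q s =
     map_option (inv_into (carrier G \<times> B) (R_class_point J \<phi> a))
       (schutz_right (R_class_point J \<phi> a ` (carrier G \<times> B)) (R_class_point J \<phi> a q) s)"

section \<open>Injective congruences on a transformation semigroup\<close>

definition ts_congruence :: "'q set \<Rightarrow> ('q \<Rightarrow> 's \<Rightarrow> 'q option) \<Rightarrow> 'q rel \<Rightarrow> bool" where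
  "ts_congruence Q act r \<longleftrightarrow> equiv Q r \<and>
     (\<forall>q q' s p p'. (q, q') \<in> r \<and> act q s = Some p \<and> act q' s = Some p' \<longrightarrow> (p, p') \<in> r)"

text \<open>The graph of the partial function on \<open>Q // r\<close> induced by \<open>s\<close>.\<close>

definition induced_map ::
  "'q set \<Rightarrow> ('q \<Rightarrow> 's \<Rightarrow> 'q option) \<Rightarrow> 'q rel \<Rightarrow> 's \<Rightarrow> 'q set rel" where
  "induced_map Q act r s =
     {(c, r `` {p}) | c q p. c \<in> Q // r \<and> q \<in> c \<and> act q s = Some p}"

definition injective_congruence :: "'q set \<Rightarrow> ('q \<Rightarrow> 's \<Rightarrow> 'q option) \<Rightarrow> 'q rel \<Rightarrow> bool" where
  "injective_congruence Q act r \<longleftrightarrow> ts_congruence Q act r \<and>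
     (\<forall>s. single_valued (induced_map Q act r s) \<and> single_valued ((induced_map Q act r s)\<inverse>))"

definition tilson_congruence :: "'q set \<Rightarrow> ('q \<Rightarrow> 's \<Rightarrow> 'q option) \<Rightarrow> 'q rel" where
  "tilson_congruence Q act = \<Inter>{r. injective_congruence Q act r}"

section \<open>The Rhodes lattice and flows\<close>

definition cross_section :: "('g \<times> 'b) set \<Rightarrow> bool" where
  "cross_section Z \<longleftrightarrow> (\<forall>g h b. (g, b) \<in> Z \<and> (h, b) \<in> Z \<longrightarrow> g = h)"

definition left_translate :: "('g, 'm) monoid_scheme \<Rightarrow> 'g \<Rightarrow> 'g \<times> 'b \<Rightarrow> 'g \<times> 'b" where
  "left_translate G g = (\<lambda>(h, b). (g \<otimes>\<^bsub>G\<^esub> h, b))"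

definition SP :: "'q set \<Rightarrow> ('q set \<times> 'q set set) set" where
  "SP Q = {(Y, P). Y \<subseteq> Q \<and> partition_on Y P}"

definition CS ::
  "('g, 'm) monoid_scheme \<Rightarrow> 'b set \<Rightarrow> (('g \<times> 'b) set \<times> ('g \<times> 'b) set set) set" where
  "CS G B = {(Y, P) \<in> SP (carrier G \<times> B).
     (\<forall>g\<in>carrier G. left_translate G g ` Y = Y \<and> (image (left_translate G g)) ` P = P) \<and>
     (\<forall>Z\<in>P. cross_section Z)}"

text \<open>The Rhodes lattice, with \<open>None\<close> as the contradiction.\<close>

definition Rh ::
  "('g, 'm) monoid_scheme \<Rightarrow> 'b set \<Rightarrow> (('g \<times> 'b) set \<times> ('g \<times> 'b) set set) option set" where
  "Rh G B = insert None (Some ` CS G B)"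

definition same_block :: "'q set set \<Rightarrow> 'q \<Rightarrow> 'q \<Rightarrow> bool" where
  "same_block P y y' \<longleftrightarrow> (\<exists>Z\<in>P. y \<in> Z \<and> y' \<in> Z)"

definition flow_step ::
  "('q \<Rightarrow> 'x \<Rightarrow> 'q option) \<Rightarrow> 'x \<Rightarrow> 'q set \<times> 'q set set \<Rightarrow> 'q set \<times> 'q set set \<Rightarrow> bool" where
  "flow_step act x = (\<lambda>(Y, P) (Z, \<Theta>).
     (\<forall>y\<in>Y. \<forall>p. act y x = Some p \<longrightarrow> p \<in> Z) \<and>
     (\<forall>y\<in>Y. \<forall>y'\<in>Y. \<forall>p p'. act y x = Some p \<and> act y' x = Some p' \<longrightarrow>
        (same_block P y y' \<longleftrightarrow> same_block \<Theta> p p')))"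

text \<open>\<open>\<delta>\<close> is the transition function of an automaton with states \<open>Q\<close> and alphabet \<open>X\<close>. A (complete)
  flow takes values in the Rhodes lattice but avoids the contradiction.\<close>

definition flow ::
  "('g, 'm) monoid_scheme \<Rightarrow> 'b set \<Rightarrow> ('g \<times> 'b \<Rightarrow> 'x \<Rightarrow> ('g \<times> 'b) option) \<Rightarrow>
   'q set \<Rightarrow> 'x set \<Rightarrow> ('q \<Rightarrow> 'x \<Rightarrow> 'q option) \<Rightarrow>
   ('q \<Rightarrow> (('g \<times> 'b) set \<times> ('g \<times> 'b) set set) option) \<Rightarrow> bool" where
  "flow G B act Q X \<delta> f \<longleftrightarrow>
     (\<forall>q\<in>Q. f q \<in> Rh G B \<and> f q \<noteq> None) \<and>
     (\<forall>p \<in> carrier G \<times> B. \<exists>q\<in>Q. p \<in> fst (the (f q))) \<and>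
     (\<forall>q\<in>Q. \<forall>x\<in>X. flow_step act x (the (f q))
        (case \<delta> q x of Some q' \<Rightarrow> the (f q') | None \<Rightarrow> ({}, {})))"

definition one_point_flow ::
  "('g, 'm) monoid_scheme \<Rightarrow> 'b set \<Rightarrow> ('g \<times> 'b \<Rightarrow> 'x \<Rightarrow> ('g \<times> 'b) option) \<Rightarrow> 'x set \<Rightarrow>
   (unit \<Rightarrow> (('g \<times> 'b) set \<times> ('g \<times> 'b) set set) option) \<Rightarrow> bool" where
  "one_point_flow G B act X \<Phi> \<longleftrightarrow> flow G B act {()} X (\<lambda>q x. Some q) \<Phi>"

end

theory Submission
  imports Defs
begin

text \<open>The Tilson congruence is the least reflexive and transitive relation that both respects and
  reflects the action: this least relation is automatically symmetric, because its converse has the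
  same closure properties. Over a regular R-class every transition \<open>q s = p\<close> is reversed by some
  \<open>x\<close> with \<open>p x = q\<close> and \<open>x s x = x\<close>, so weak conjugation by the pair \<open>(x, s)\<close> shows that
  ``reachable by an element of \<open>S\<^bsub>II\<^esub>\<close>'' also has these closure properties. Hence \<open>\<tau>\<close>-related points
  are joined by elements of \<open>S\<^bsub>II\<^esub>\<close>. Conversely such elements move every point inside its class for
  any injective congruence. So a failure of the cross-section property is exactly a non-trivial
  subgroup of \<open>S\<^bsub>II\<^esub> \<inter> I(S)\<close>; and a one-point flow is an invariant injective congruence whose
  classes are cross-sections.\<close>

section \<open>The least injective congruence\<close>

text \<open>The premises \<open>q \<in> Q\<close> and \<open>q' \<in> Q\<close> of
  \<open>backward\<close> keep the relation inside \<open>Q\<close>, since \<open>act\<close> is a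
  function on the whole type. In \<open>forward\<close> membership comes from closure of
  \<open>Q\<close> under the action.\<close>

inductive_set biclosure :: "'q set \<Rightarrow> ('q \<Rightarrow> 's \<Rightarrow> 'q option) \<Rightarrow> 'q rel"
  for Q act where
  same: "q \<in> Q \<Longrightarrow> (q, q) \<in> biclosure Q act"
| comp: "(q, q') \<in> biclosure Q act \<Longrightarrow> (q', q'') \<in> biclosure Q act
    \<Longrightarrow> (q, q'') \<in> biclosure Q act"
| forward: "(q, q') \<in> biclosure Q act \<Longrightarrow> act q s = Some p \<Longrightarrow> act q' s = Some p'
    \<Longrightarrow> (p, p') \<in> biclosure Q act"
| backward: "(p, p') \<in> biclosure Q act \<Longrightarrow> q \<in> Q \<Longrightarrow> q' \<in> Q
    \<Longrightarrow> act q s = Some p \<Longrightarrow> act q' s = Some p' \<Longrightarrow> (q, q') \<in> biclosure Q act"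

lemma biclosure_sym:
  "(q, q') \<in> biclosure Q act \<Longrightarrow> (q', q) \<in> biclosure Q act"
  by (induction rule: biclosure.induct) (blast intro: biclosure.intros)+

lemma same_block_quotient:
  assumes "equiv Q r"
  shows "same_block (Q // r) y y' \<longleftrightarrow> (y, y') \<in> r"
proof
  assume r: "(y, y') \<in> r"
  then have "y \<in> Q" using assms by (meson equivE mem_Sigma_iff subsetD refl_on_def)
  then show "same_block (Q // r) y y'"
    unfolding same_block_def using r quotientI[of y Q r] equiv_class_self[OF assms, of y] by blast
qed (use assms in \<open>auto simp: same_block_def dest: quotient_eq_iff\<close>)

section \<open>Injective congruences of a semigroup acting by partial functions\<close>

locale partial_action =
  fixes Q :: "'q set" and act :: "'q \<Rightarrow> 's::semigroup_mult \<Rightarrow> 'q option"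
  assumes act_closed: "q \<in> Q \<Longrightarrow> act q s = Some p \<Longrightarrow> p \<in> Q"
    and act_mult: "q \<in> Q \<Longrightarrow>
      act q (s * t) = Some p \<longleftrightarrow> (\<exists>m\<in>Q. act q s = Some m \<and> act m t = Some p)"
begin

text \<open>Single-valuedness of the induced map says that relatedness passes from points to images,
  and single-valuedness of its converse says that it passes back. This pointwise form avoids
  quotients in all later arguments.\<close>

lemma injective_congruence_iff:
  "injective_congruence Q act r \<longleftrightarrow> equiv Q r \<and>
     (\<forall>q\<in>Q. \<forall>q'\<in>Q. \<forall>s p p'. act q s = Some p \<and> act q' s = Some p' \<longrightarrow>
        ((q, q') \<in> r \<longleftrightarrow> (p, p') \<in> r))" (is "_ \<longleftrightarrow> equiv Q r \<and> ?bi")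
proof (cases "equiv Q r")
  case eq: True
  have class_eq: "r `` {x} = r `` {y} \<longleftrightarrow> (x, y) \<in> r" if "x \<in> Q" "y \<in> Q" for x y
    using eq that by (simp add: eq_equiv_class_iff)
  have field: "x \<in> Q \<and> y \<in> Q" if "(x, y) \<in> r" for x y
    using eq that by (auto simp: equiv_def refl_on_def)
  have same_class: "(x, y) \<in> r" if "c \<in> Q // r" "x \<in> c" "y \<in> c" for c x y
    using eq that by (meson in_quotient_imp_closed quotient_eq_iff)
  show ?thesis
  proof
    assume inj: "injective_congruence Q act r"
    have "(q, q') \<in> r" if "q \<in> Q" "q' \<in> Q" "act q s = Some p" "act q' s = Some p'" "(p, p') \<in> r"
      for q q' s p p'
    proof -
      have mem: "(r `` {x}, r `` {y}) \<in> induced_map Q act r s"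
        if "x \<in> Q" "act x s = Some y" for x y
        unfolding induced_map_def using that quotientI[of x Q r] equiv_class_self[OF eq, of x]
        by blast
      have "r `` {p} = r `` {p'}"
        using eq \<open>(p, p') \<in> r\<close> by (rule equiv_class_eq)
      then have "r `` {q} = r `` {q'}"
        using inj mem[OF that(1,3)] mem[OF that(2,4)]
        unfolding injective_congruence_def single_valued_def by (metis converseI)
      then show ?thesis using class_eq that by blast
    qed
    then show "equiv Q r \<and> ?bi"
      using inj unfolding injective_congruence_def ts_congruence_def by blast
  next
    assume bi: "equiv Q r \<and> ?bi"
    have "single_valued (induced_map Q act r s)" for s
    proof (rule single_valuedI)
      fix c d d' assume "(c, d) \<in> induced_map Q act r s" "(c, d') \<in> induced_map Q act r s"
      then obtain q p q' p' where *: "c \<in> Q // r" "q \<in> c" "q' \<in> c"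
        "act q s = Some p" "act q' s = Some p'" "d = r `` {p}" "d' = r `` {p'}"
        unfolding induced_map_def by auto
      then have "(q, q') \<in> r" using same_class by blast
      then have "(p, p') \<in> r" using bi field * by blast
      then show "d = d'" using eq * by (simp add: equiv_class_eq)
    qed
    moreover have "single_valued ((induced_map Q act r s)\<inverse>)" for s
    proof (rule single_valuedI)
      fix d c c' assume "(d, c) \<in> (induced_map Q act r s)\<inverse>" "(d, c') \<in> (induced_map Q act r s)\<inverse>"
      then obtain q p q' p' where *: "c \<in> Q // r" "c' \<in> Q // r" "q \<in> c" "q' \<in> c'"
        "act q s = Some p" "act q' s = Some p'" "r `` {p} = r `` {p'}"
        unfolding induced_map_def by auto
      have Q: "q \<in> Q" "q' \<in> Q" using same_class * field by blast+
      then have "p \<in> Q" "p' \<in> Q" using act_closed * by blast+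
      then have "(q, q') \<in> r" using bi Q * class_eq by blast
      then show "c = c'" using eq * by (meson quotient_eq_iff)
    qed
    ultimately show "injective_congruence Q act r"
      using bi field unfolding injective_congruence_def ts_congruence_def by blast
  qed
qed (auto simp: injective_congruence_def ts_congruence_def)

lemma injective_congruenceD:
  assumes "injective_congruence Q act r"
  shows "equiv Q r"
    and "q \<in> Q \<Longrightarrow> q' \<in> Q \<Longrightarrow> act q s = Some p \<Longrightarrow> act q' s = Some p' \<Longrightarrow>
      (q, q') \<in> r \<longleftrightarrow> (p, p') \<in> r"
  using assms unfolding injective_congruence_iff by blast+

lemma biclosure_in: "(q, q') \<in> biclosure Q act \<Longrightarrow> q \<in> Q \<and> q' \<in> Q"
  by (induction rule: biclosure.induct) (use act_closed in blast)+

lemma injective_congruence_biclosure: "injective_congruence Q act (biclosure Q act)"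
proof -
  have "equiv Q (biclosure Q act)"
    using biclosure_in
    by (auto intro!: equivI refl_onI symI transI
        intro: biclosure.same biclosure.comp biclosure_sym)
  then show ?thesis
    unfolding injective_congruence_iff
    by (blast intro: biclosure.forward biclosure.backward)
qed

lemma biclosure_subset:
  assumes inj: "injective_congruence Q act r"
  shows "biclosure Q act \<subseteq> r"
proof -
  have "(q, q') \<in> r" if "(q, q') \<in> biclosure Q act" for q q'
    using that
  proof (induction rule: biclosure.induct)
    case (same q)
    then show ?case using injective_congruenceD(1)[OF inj] by (meson equivE refl_onD)
  next
    case (comp q q' q'')
    then show ?case using injective_congruenceD(1)[OF inj] by (meson equivE transE)
  next
    case (forward q q' s p p')
    then show ?case using injective_congruenceD(2)[OF inj] biclosure_in by blast
  next
    case (backward p p' q q' s)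
    then show ?case using injective_congruenceD(2)[OF inj] by blast
  qed
  then show ?thesis by auto
qed

lemma tilson_congruence_eq_biclosure: "tilson_congruence Q act = biclosure Q act"
  unfolding tilson_congruence_def
  using injective_congruence_biclosure biclosure_subset by blast

text \<open>A self-map of \<open>Q\<close> commuting with the action sends each instance of a
  closure rule to another instance. Applied to left translations, it makes \<open>\<tau>\<close>
  invariant under \<open>G\<close>.\<close>

lemma biclosure_equivariant:
  assumes T: "\<And>x. x \<in> Q \<Longrightarrow> T x \<in> Q"
    and act_T: "\<And>x s y. x \<in> Q \<Longrightarrow> act x s = Some y \<Longrightarrow> act (T x) s = Some (T y)"
  shows "(q, q') \<in> biclosure Q act \<Longrightarrow> (T q, T q') \<in> biclosure Q act"
proof (induction rule: biclosure.induct)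
  case (same q)
  then show ?case using T by (blast intro: biclosure.same)
next
  case (comp q q' q'')
  then show ?case by (blast intro: biclosure.comp)
next
  case (forward q q' s p p')
  then show ?case
    using biclosure_in act_T by (meson biclosure.forward)
next
  case (backward p p' q q' s)
  then show ?case
    using T act_T by (meson biclosure.backward)
qed

text \<open>Induction over the closure rules of \<open>type_II\<close>: modulo an injective
  congruence, idempotents and weak conjugates fix every class on which they are defined.\<close>

lemma type_II_within_class:
  assumes inj: "injective_congruence Q act r" and "s \<in> type_II"
  shows "q \<in> Q \<Longrightarrow> act q s = Some p \<Longrightarrow> (q, p) \<in> r"
proof -
  note eq = injective_congruenceD(1)[OF inj] and bi = injective_congruenceD(2)[OF inj]
  from assms(2) show "q \<in> Q \<Longrightarrow> act q s = Some p \<Longrightarrow> (q, p) \<in> r"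
  proof (induction arbitrary: q p rule: type_II.induct)
    case (idem e)
    \<comment> \<open>Idempotence gives \<open>p e = p = q e\<close>, so \<open>q\<close> and
      \<open>p\<close> have the same image under \<open>e\<close> and are related by
      reflection.\<close>
    then have "act q (e * e) = Some p" by simp
    then have "act p e = Some p" using idem act_mult[of q e e p] by auto
    moreover have "p \<in> Q" using act_closed idem by blast
    moreover from this have "(p, p) \<in> r" using eq \<open>p \<in> Q\<close> by (meson equivE refl_onD)
    ultimately show ?case using bi idem by blast
  next
    case (mult s t)
    then obtain m where "m \<in> Q" "act q s = Some m" "act m t = Some p"
      by (auto simp: act_mult)
    then show ?case using mult eq by (meson equivE transE)
  next
    case (conj_left x y s)
    obtain m m' where m: "m \<in> Q" "m' \<in> Q" "act q x = Some m" "act m s = Some m'" "act m' y = Some p"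
      using conj_left.prems by (auto simp: act_mult)
    \<comment> \<open>Put \<open>n = q x y\<close>. Both \<open>q\<close> and \<open>n\<close> go to
      \<open>m\<close> under \<open>x\<close>, hence are related; \<open>n\<close> and
      \<open>p\<close> are the images under \<open>y\<close> of the related points \<open>m\<close>
      and \<open>m'\<close>.\<close>
    have "act q (x * y * x) = Some m" using conj_left.hyps m by simp
    then obtain n where n: "n \<in> Q" "act m y = Some n" "act n x = Some m"
      using conj_left.prems(1) m(3) by (auto simp: act_mult)
    have "(m, m) \<in> r" using eq m by (meson equivE refl_onD)
    then have "(q, n) \<in> r" using bi n m conj_left.prems by blast
    moreover have "(n, p) \<in> r" using conj_left.IH m n bi by blast
    ultimately show ?case using eq by (meson equivE transE)
  next
    case (conj_right x y s)
    obtain m m' where m: "m \<in> Q" "m' \<in> Q" "act q y = Some m" "act m s = Some m'" "act m' x = Some p"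
      using conj_right.prems by (auto simp: act_mult)
    \<comment> \<open>Put \<open>n = p y\<close>. Both \<open>m'\<close> and \<open>n\<close> go to
      \<open>p\<close> under \<open>x\<close>, so \<open>m\<close>, \<open>m'\<close>,
      \<open>n\<close> lie in one class; as \<open>q y = m\<close> and \<open>p y = n\<close>,
      reflecting along \<open>y\<close> relates \<open>q\<close> and \<open>p\<close>.\<close>
    have "act m' (x * y * x) = Some p" using conj_right.hyps m by simp
    then obtain n where n: "n \<in> Q" "act p y = Some n" "act n x = Some p"
      using m by (auto simp: act_mult)
    have "p \<in> Q" using act_closed m by blast
    then have "(p, p) \<in> r" using eq by (meson equivE refl_onD)
    then have "(m', n) \<in> r" using bi n m by blast
    moreover have "(m, m') \<in> r" using conj_right.IH m by blast
    ultimately have "(m, n) \<in> r" using eq by (meson equivE transE)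
    then show ?case using bi n m conj_right.prems \<open>p \<in> Q\<close> by blast
  qed
qed

end

section \<open>The action on a regular R-class in Rees coordinates\<close>

text \<open>The flag \<open>z\<close> is a parameter, so that semigroups with and without zero are
  treated by one argument.\<close>

locale rees_R_class = group G
  for G :: "('g, 'm) monoid_scheme" (structure) +
  fixes z :: bool and J :: "'s::semigroup_mult set" and A :: "'a set" and B :: "'b set"
    and C :: "'b \<Rightarrow> 'a \<Rightarrow> 'g option" and \<phi> :: "'s \<Rightarrow> ('a \<times> 'g \<times> 'b) option" and a :: 'a
  assumes ideal: "two_sided_ideal J"
    and regular: "regular_semigroup J"
    and sandwich: "sandwich_matrix z G A B C"
    and iso: "rees_iso z J G A B C \<phi>"
    and a_in: "a \<in> A"
begin

abbreviation "Q \<equiv> carrier G \<times> B"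
abbreviation "pt \<equiv> R_class_point J \<phi> a"
abbreviation "act \<equiv> GB_act J G B \<phi> a"

section \<open>Rees coordinates of elements of \<open>J\<close> and of the points of the
  R-class\<close>

lemma mult_in_J: "x \<in> J \<Longrightarrow> x * s \<in> J" "x \<in> J \<Longrightarrow> s * x \<in> J"
  using ideal unfolding two_sided_ideal_def by auto

lemma phi_mult: "x \<in> J \<Longrightarrow> y \<in> J \<Longrightarrow> \<phi> (x * y) = rees_mult G C (\<phi> x) (\<phi> y)"
  using iso unfolding rees_iso_def by auto

lemma phi_eqD: "\<phi> x = \<phi> y \<Longrightarrow> x \<in> J \<Longrightarrow> y \<in> J \<Longrightarrow> x = y"
  using iso unfolding rees_iso_def bij_betw_def inj_on_def by auto

lemma phi_coords:
  assumes "x \<in> J" "\<phi> x = Some (a', g, b)"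
  shows "a' \<in> A" "g \<in> carrier G" "b \<in> B"
proof -
  have "\<phi> x \<in> rees_carrier z G A B"
    using iso assms(1) unfolding rees_iso_def bij_betw_def by blast
  then show "a' \<in> A" "g \<in> carrier G" "b \<in> B"
    using assms by (auto simp: rees_carrier_def split: if_splits)
qed

lemma phi_surj:
  assumes "a' \<in> A" "g \<in> carrier G" "b \<in> B"
  shows "\<exists>x\<in>J. \<phi> x = Some (a', g, b)"
proof -
  have "Some (a', g, b) \<in> \<phi> ` J"
    using iso assms unfolding rees_iso_def bij_betw_def rees_carrier_def by auto
  then show ?thesis by (metis imageE)
qed

lemma pt_in: "q \<in> Q \<Longrightarrow> pt q \<in> J" and phi_pt: "q \<in> Q \<Longrightarrow> \<phi> (pt q) = Some (a, q)"
proof -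
  assume "q \<in> Q"
  then have "Some (a, q) \<in> \<phi> ` J"
    using iso a_in unfolding rees_iso_def bij_betw_def rees_carrier_def by auto
  then show "pt q \<in> J" "\<phi> (pt q) = Some (a, q)"
    unfolding R_class_point_def by (auto intro: inv_into_into f_inv_into_f)
qed

lemma inj_pt: "inj_on pt Q"
  by (rule inj_onI) (metis phi_pt option.inject prod.inject)

lemma pt_image_iff: "x \<in> J \<Longrightarrow> x \<in> pt ` Q \<longleftrightarrow> (\<exists>q. \<phi> x = Some (a, q))"
proof
  assume "x \<in> J" "\<exists>q. \<phi> x = Some (a, q)"
  then obtain g b where gb: "\<phi> x = Some (a, g, b)" by auto
  then have "(g, b) \<in> Q" using phi_coords[OF \<open>x \<in> J\<close>] by auto
  moreover from this have "x = pt (g, b)"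
    using gb \<open>x \<in> J\<close> phi_pt pt_in by (intro phi_eqD) auto
  ultimately show "x \<in> pt ` Q" by blast
qed (use phi_pt in auto)

text \<open>Replaces the \<open>option\<close> values and inverse functions of \<open>GB_act\<close>
  by an equation in the semigroup.\<close>

lemma act_iff:
  assumes "q \<in> Q"
  shows "act q s = Some p \<longleftrightarrow> p \<in> Q \<and> pt q * s = pt p"
proof (cases "pt q * s \<in> pt ` Q")
  case True
  then obtain p' where p': "p' \<in> Q" "pt q * s = pt p'" by blast
  then have "act q s = Some p'"
    using inj_pt by (simp add: GB_act_def schutz_right_def del: mem_Sigma_iff)
  then show ?thesis using p' inj_pt by (auto dest: inj_onD simp del: mem_Sigma_iff)
next
  case False
  then show ?thesis by (auto simp: GB_act_def schutz_right_def simp del: mem_Sigma_iff)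
qed

section \<open>Consequences of regularity for the sandwich matrix and for the action\<close>

lemma sandwich_carrier: "b \<in> B \<Longrightarrow> a' \<in> A \<Longrightarrow> C b a' = Some c \<Longrightarrow> c \<in> carrier G"
  using sandwich unfolding sandwich_matrix_def by (force split: if_splits)

lemma rees_mult_left: "rees_mult G C (Some (a', q)) y = None \<or>
    (\<exists>q'. rees_mult G C (Some (a', q)) y = Some (a', q'))"
  by (cases y; cases q) (auto split: option.splits)

lemma regular_inverse: "x \<in> J \<Longrightarrow> \<exists>y\<in>J. x * y * x = x"
  using regular unfolding regular_semigroup_def by auto

text \<open>For a regular element \<open>x = x y x\<close> with coordinates
  \<open>(a, \<one>, b)\<close>, the product on the right is nonzero. Its first factor pair meets
  row \<open>b\<close> of \<open>C\<close>, and its second meets column \<open>a\<close>, which is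
  read off in \<open>sandwich_column\<close>.\<close>

lemma sandwich_row:
  assumes "b \<in> B"
  obtains a' c where "a' \<in> A" "c \<in> carrier G" "C b a' = Some c"
proof -
  have q: "(\<one>, b) \<in> Q" using assms by auto
  obtain y where y: "y \<in> J" "pt (\<one>, b) * y * pt (\<one>, b) = pt (\<one>, b)"
    using regular_inverse pt_in[OF q] by blast
  have "rees_mult G C (rees_mult G C (Some (a, \<one>, b)) (\<phi> y)) (Some (a, \<one>, b)) = Some (a, \<one>, b)"
    using y q by (metis phi_mult mult_in_J(1) pt_in phi_pt)
  then obtain a' g b' c where *: "\<phi> y = Some (a', g, b')" "C b a' = Some c"
    by (cases "\<phi> y") (auto split: option.splits)
  note coords = phi_coords[OF y(1) *(1)]
  show ?thesis by (rule that[OF coords(1) sandwich_carrier[OF assms coords(1) *(2)] *(2)])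
qed

lemma sandwich_column:
  assumes "b \<in> B"
  obtains b' c where "b' \<in> B" "c \<in> carrier G" "C b' a = Some c"
proof -
  have q: "(\<one>, b) \<in> Q" using assms by auto
  obtain y where y: "y \<in> J" "pt (\<one>, b) * y * pt (\<one>, b) = pt (\<one>, b)"
    using regular_inverse pt_in[OF q] by blast
  have "rees_mult G C (rees_mult G C (Some (a, \<one>, b)) (\<phi> y)) (Some (a, \<one>, b)) = Some (a, \<one>, b)"
    using y q by (metis phi_mult mult_in_J(1) pt_in phi_pt)
  then obtain a' g b' c where *: "\<phi> y = Some (a', g, b')" "C b' a = Some c"
    by (cases "\<phi> y") (auto split: option.splits)
  note coords = phi_coords[OF y(1) *(1)]
  show ?thesis by (rule that[OF coords(3) sandwich_carrier[OF coords(3) a_in *(2)] *(2)])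
qed

text \<open>A product that has left the R-class cannot return to it. Since \<open>\<phi>\<close> is
  multiplicative only on \<open>J\<close> while \<open>s\<close> and \<open>t\<close> are arbitrary,
  regularity is used to replace them by factors in \<open>J\<close>.\<close>

lemma pt_mult_image:
  assumes q: "q \<in> Q" and st: "pt q * s * t \<in> pt ` Q"
  shows "pt q * s \<in> pt ` Q"
proof -
  let ?u = "pt q * s * t"
  obtain y where y: "y \<in> J" "pt q * y * pt q = pt q"
    using regular_inverse pt_in[OF q] by blast
  have uJ: "?u \<in> J" using q by (simp add: mult_in_J pt_in)
  obtain w where w: "w \<in> J" "?u * w * ?u = ?u"
    using regular_inverse uJ by blast
  \<comment> \<open>Now \<open>t\<close> is absorbed into a factor in \<open>J\<close>, so
    \<open>pt q * s\<close> cannot have coordinate \<open>None\<close>.\<close>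
  have "?u = (pt q * s) * (t * w * ?u)"
    using w(2) by (simp add: mult.assoc)
  then have "\<phi> ?u = rees_mult G C (\<phi> (pt q * s)) (\<phi> (t * w * ?u))"
    using uJ q by (metis phi_mult mult_in_J pt_in)
  moreover have "\<phi> ?u \<noteq> None" using st phi_pt by auto
  ultimately have nz: "\<phi> (pt q * s) \<noteq> None"
    by (metis rees_mult.simps(2))
  \<comment> \<open>A nonzero product in \<open>J\<close> keeps the first coordinate
    \<open>a\<close> of its left factor.\<close>
  have "pt q * s = pt q * (y * (pt q * s))"
    using y(2) by (simp add: mult.assoc[symmetric])
  then have "\<phi> (pt q * s) = rees_mult G C (Some (a, q)) (\<phi> (y * (pt q * s)))"
    using q y(1) by (metis phi_mult mult_in_J(1) pt_in phi_pt)
  then show ?thesis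
    using nz rees_mult_left[of a q] q by (metis pt_image_iff mult_in_J(1) pt_in)
qed

lemma schutz_mult:
  assumes "q \<in> Q"
  shows "act q (s * t) = Some p \<longleftrightarrow> (\<exists>m\<in>Q. act q s = Some m \<and> act m t = Some p)"
proof
  assume "act q (s * t) = Some p"
  then have p: "p \<in> Q" "pt q * s * t = pt p"
    using assms by (auto simp: act_iff mult.assoc)
  then obtain m where "m \<in> Q" "pt q * s = pt m"
    using pt_mult_image[OF assms, of s t] by auto
  then show "\<exists>m\<in>Q. act q s = Some m \<and> act m t = Some p"
    using assms p by (auto simp: act_iff)
qed (use assms in \<open>auto simp: act_iff mult.assoc[symmetric]\<close>)

sublocale partial_action Q act
  by unfold_locales (use act_iff schutz_mult in blast)+

lemma pt_transitive:
  assumes "q \<in> Q" "p \<in> Q"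
  obtains w where "pt p * w = pt q"
proof -
  obtain g b h b' where [simp]: "q = (g, b)" "p = (h, b')" by (cases q; cases p)
  have mem: "g \<in> carrier G" "b \<in> B" "h \<in> carrier G" "b' \<in> B" using assms by auto
  obtain a' c where c: "a' \<in> A" "c \<in> carrier G" "C b' a' = Some c"
    using sandwich_row mem by blast
  \<comment> \<open>The middle coordinate solves \<open>h \<otimes> c \<otimes> k = g\<close> for
    \<open>k\<close>.\<close>
  obtain w where w: "w \<in> J" "\<phi> w = Some (a', m_inv G (h \<otimes> c) \<otimes> g, b)"
    using phi_surj[of a' "m_inv G (h \<otimes> c) \<otimes> g" b] c mem by auto
  have "\<phi> (pt p * w) = \<phi> (pt q)"
    using w c mem assms by (simp add: phi_mult pt_in phi_pt m_assoc[symmetric])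
  then have "pt p * w = pt q"
    using w assms by (intro phi_eqD) (auto intro: mult_in_J pt_in)
  then show ?thesis using that by blast
qed

text \<open>Supplies the conjugating pair \<open>(x, s)\<close> needed to run a transition
  backwards.\<close>

lemma act_weak_inverse:
  assumes "q \<in> Q" "act q s = Some p"
  obtains x where "act p x = Some q" "x * s * x = x"
proof -
  have p: "p \<in> Q" "pt q * s = pt p" using assms by (auto simp: act_iff)
  obtain y where y: "pt q * y * pt q = pt q"
    using regular_inverse pt_in[OF assms(1)] by blast
  obtain w where w: "pt p * w = pt q"
    using pt_transitive[OF assms(1) p(1)] .
  \<comment> \<open>Appending \<open>y * pt q\<close> to \<open>w\<close> still carries
    \<open>pt p\<close> to \<open>pt q\<close>. In \<open>x s x\<close> the inner factor
    \<open>pt q * s * w\<close> then collapses to \<open>pt q\<close>, and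
    \<open>pt q * y * pt q = pt q\<close> finishes.\<close>
  let ?x = "w * y * pt q"
  have "pt p * ?x = pt q"
    using w y by (simp add: mult.assoc[symmetric])
  then have "act p ?x = Some q" using p assms by (simp add: act_iff)
  moreover have "?x * s * ?x = w * y * (pt q * s * w) * y * pt q"
    by (simp add: mult.assoc)
  then have "?x * s * ?x = ?x"
    using p(2) w y by (simp add: mult.assoc)
  ultimately show ?thesis using that by blast
qed

lemma idempotent_at:
  assumes "b \<in> B"
  obtains e a' c where "e \<in> J" "e * e = e" "a' \<in> A" "c \<in> carrier G" "C b a' = Some c"
    "\<phi> e = Some (a', m_inv G c, b)"
proof -
  obtain a' c where c: "a' \<in> A" "c \<in> carrier G" "C b a' = Some c"
    using sandwich_row assms by blast
  obtain e where e: "e \<in> J" "\<phi> e = Some (a', m_inv G c, b)"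
    using phi_surj[of a' "m_inv G c" b] c assms by auto
  have "\<phi> (e * e) = \<phi> e" using e c by (simp add: phi_mult)
  then have "e * e = e" using e by (intro phi_eqD) (auto intro: mult_in_J)
  then show ?thesis using that e c by blast
qed

lemma act_J:
  assumes "g \<in> carrier G" "b \<in> B" "x \<in> J" "\<phi> x = Some (a', k, b')" "C b a' = Some c"
  shows "act (g, b) x = Some (g \<otimes> c \<otimes> k, b')"
proof -
  note k = phi_coords[OF assms(3,4)]
  have c: "c \<in> carrier G" using sandwich_carrier k assms by blast
  have "\<phi> (pt (g, b) * x) = \<phi> (pt (g \<otimes> c \<otimes> k, b'))"
    using assms c k by (simp add: phi_mult pt_in phi_pt)
  then have "pt (g, b) * x = pt (g \<otimes> c \<otimes> k, b')"
    using assms c k by (intro phi_eqD) (auto intro: mult_in_J pt_in)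
  then show ?thesis using assms c k by (simp add: act_iff)
qed

section \<open>Type II elements and injective congruences\<close>

text \<open>The rules of the two closures match: \<open>same\<close> uses an idempotent,
  \<open>comp\<close> a product, \<open>forward\<close> and \<open>backward\<close> the two weak
  conjugations.\<close>

lemma biclosure_type_II:
  "(q, q') \<in> biclosure Q act \<Longrightarrow> q \<in> Q \<and> q' \<in> Q \<and> (\<exists>t\<in>type_II. act q t = Some q')"
proof (induction rule: biclosure.induct)
  case (same q)
  obtain g b where q: "q = (g, b)" "g \<in> carrier G" "b \<in> B" using same by auto
  obtain e a' c where e: "e \<in> J" "e * e = e" "a' \<in> A" "c \<in> carrier G" "C b a' = Some c"
    "\<phi> e = Some (a', m_inv G c, b)"
    using idempotent_at q by blast
  have "act q e = Some q"
    using act_J[OF q(2,3) e(1,6,5)] q e by (simp add: m_assoc)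
  then show ?case using same type_II.idem[OF e(2)] by blast
next
  case (comp q q' q'')
  then obtain t t' where "t \<in> type_II" "t' \<in> type_II" "act q t = Some q'" "act q' t' = Some q''"
    by blast
  then have "t * t' \<in> type_II" "act q (t * t') = Some q''"
    using comp by (auto simp: act_mult intro: type_II.mult)
  then show ?case using comp by blast
next
  case (forward q q' s p p')
  then obtain t where t: "t \<in> type_II" "act q t = Some q'" and Q: "q \<in> Q" "q' \<in> Q" by blast
  obtain x where x: "act p x = Some q" "x * s * x = x"
    using act_weak_inverse Q forward by blast
  have p: "p \<in> Q" "p' \<in> Q" using act_closed Q forward by blast+
  \<comment> \<open>The path is \<open>p\<close> to \<open>q\<close> by \<open>x\<close>, to
    \<open>q'\<close> by \<open>t\<close>, to \<open>p'\<close> by \<open>s\<close>.\<close>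
  have "act p (x * t * s) = Some p'"
    using p Q x t forward by (auto simp: act_mult)
  then show ?case using p type_II.conj_left[OF x(2) t(1)] by blast
next
  case (backward p p' q q' s)
  then obtain t where t: "t \<in> type_II" "act p t = Some p'" and p: "p \<in> Q" "p' \<in> Q" by blast
  obtain x where x: "act p' x = Some q'" "x * s * x = x"
    using act_weak_inverse backward by blast
  \<comment> \<open>Here \<open>x\<close> reverses the transition of \<open>q'\<close>: the path is
    \<open>q\<close> to \<open>p\<close> to \<open>p'\<close> to \<open>q'\<close>.\<close>
  have "act q (s * t * x) = Some q'"
    using p x t backward by (auto simp: act_mult)
  then show ?case using backward type_II.conj_right[OF x(2) t(1)] by blast
qed

text \<open>A subgroup whose identity is not the zero \<open>None\<close> has constant outer Rees
  coordinates. Its elements move \<open>(\<one>, b)\<close> within its class and keep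
  \<open>b\<close>, so the cross-section property forces equal middle coordinates.\<close>

lemma aperiodic_if_cross_section:
  assumes inj: "injective_congruence Q act r"
    and cs: "\<And>g h b. g \<in> carrier G \<Longrightarrow> h \<in> carrier G \<Longrightarrow> b \<in> B \<Longrightarrow> ((g, b), (h, b)) \<in> r \<Longrightarrow> g = h"
  shows "aperiodic (type_II \<inter> J)"
  unfolding aperiodic_def
proof (intro allI impI)
  fix H e assume H: "H \<subseteq> type_II \<inter> J \<and> group \<lparr>carrier = H, monoid.mult = (*), one = e\<rparr>"
  then interpret H: group "\<lparr>carrier = H, monoid.mult = (*), one = e\<rparr>" by blast
  have e: "e \<in> H" "e \<in> J" using H.one_closed H by auto
  have "h = e" if h: "h \<in> H" for h
  proof -
    have hJ: "h \<in> J" "h \<in> type_II" using h H by auto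
    have eh: "e * h = h" "h * e = h" "e * e = e"
      using H.l_one[of h] H.r_one[of h] H.l_one[of e] h e by auto
    have phi_eh: "\<phi> h = rees_mult G C (\<phi> e) (\<phi> h)" "\<phi> h = rees_mult G C (\<phi> h) (\<phi> e)"
      "\<phi> e = rees_mult G C (\<phi> e) (\<phi> e)"
      using phi_mult[OF e(2) hJ(1)] phi_mult[OF hJ(1) e(2)] phi_mult[OF e(2) e(2)] eh by auto
    show "h = e"
    proof (cases "\<phi> e")
      case None
      then show ?thesis using phi_eh hJ e by (intro phi_eqD) auto
    next
      case (Some u)
      obtain a' k b where u: "\<phi> e = Some (a', k, b)" using Some by (cases u) auto
      note ecoords = phi_coords[OF e(2) u]
      obtain c where c: "C b a' = Some c" "k \<otimes> c \<otimes> k = k"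
        using phi_eh(3) u by (auto split: option.splits)
      have cG: "c \<in> carrier G" using sandwich_carrier c ecoords by blast
      \<comment> \<open>A group inverse of \<open>h\<close> multiplies it to the nonzero
        \<open>e\<close>.\<close>
      have "\<phi> h \<noteq> None"
      proof
        assume hn: "\<phi> h = None"
        obtain h' where "h' \<in> H" "h' * h = e"
          using H.l_inv_ex[of h] h by auto
        then have "\<phi> e = rees_mult G C (\<phi> h') (\<phi> h)"
          using phi_mult H hJ by blast
        then show False using hn u by (cases "\<phi> h'") auto
      qed
      then obtain a2 k2 b2 where v: "\<phi> h = Some (a2, k2, b2)" by auto
      \<comment> \<open>The first coordinate comes from \<open>e * h = h\<close>, the last from
        \<open>h * e = h\<close>.\<close>
      have [simp]: "a2 = a'" "b2 = b"
        using phi_eh(1,2) u v by (auto split: option.splits)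
      note hcoords = phi_coords[OF hJ(1) v]
      have "act (\<one>, b) h = Some (\<one> \<otimes> c \<otimes> k2, b)" "act (\<one>, b) e = Some (\<one> \<otimes> c \<otimes> k, b)"
        using act_J ecoords hJ(1) e(2) u v c(1) by auto
      moreover have "e \<in> type_II" using e H by blast
      ultimately have rel: "((\<one>, b), (\<one> \<otimes> c \<otimes> k2, b)) \<in> r" "((\<one>, b), (\<one> \<otimes> c \<otimes> k, b)) \<in> r"
        using type_II_within_class[OF inj] hJ(2) ecoords by auto
      have "\<one> = \<one> \<otimes> c \<otimes> k2" "\<one> = \<one> \<otimes> c \<otimes> k"
        by (rule cs[OF _ _ _ rel(1)] cs[OF _ _ _ rel(2)]; use ecoords hcoords cG in simp)+
      then have "\<one> \<otimes> c \<otimes> k2 = \<one> \<otimes> c \<otimes> k" by (rule subst)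
      then have "k2 = k" using cG ecoords hcoords by simp
      then show ?thesis using u v hJ e by (intro phi_eqD) auto
    qed
  qed
  then show "H = {e}" using e by blast
qed

text \<open>Related points over the same \<open>b\<close> are joined by some \<open>t\<close> in
  \<open>type_II\<close>. Cutting \<open>t\<close> down by an idempotent puts it into a subgroup of
  \<open>type_II \<inter> J\<close>, which is trivial.\<close>

lemma cross_section_if_aperiodic:
  assumes ap: "aperiodic (type_II \<inter> J)" and "finite J"
    and rel: "((g, b), (h, b)) \<in> biclosure Q act"
  shows "g = h"
proof -
  obtain t where t: "t \<in> type_II" "act (g, b) t = Some (h, b)"
    and gh: "g \<in> carrier G" "b \<in> B" "h \<in> carrier G"
    using biclosure_type_II[OF rel] by auto
  obtain e a' c where e: "e \<in> J" "e * e = e" "a' \<in> A" "c \<in> carrier G" "C b a' = Some c"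
    "\<phi> e = Some (a', m_inv G c, b)"
    using idempotent_at gh by blast
  \<comment> \<open>The type II elements sharing both outer coordinates with \<open>e\<close>; as
    \<open>C b a'\<close> is nonzero, \<open>H\<close> is closed under multiplication.\<close>
  define H where "H = {x \<in> type_II \<inter> J. \<exists>k. \<phi> x = Some (a', k, b)}"
  have HJ: "x \<in> J" if "x \<in> H" for x using that by (simp add: H_def)
  have eH: "e \<in> H" using e type_II.idem by (auto simp: H_def)
  have Hmult: "x * y \<in> H" if "x \<in> H" "y \<in> H" for x y
    using that e by (auto simp: H_def phi_mult mult_in_J intro: type_II.mult)
  have He: "e * x = x" if x: "x \<in> H" for x
  proof (rule phi_eqD)
    obtain k where "x \<in> J" "\<phi> x = Some (a', k, b)" using x by (auto simp: H_def)
    then show "\<phi> (e * x) = \<phi> x" using e phi_coords by (auto simp: phi_mult)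
  qed (use x HJ e in \<open>auto intro: mult_in_J\<close>)
  have cancel: "x = y" if xyw: "x \<in> H" "y \<in> H" "w \<in> H" "x * w = y * w" for x y w
  proof -
    obtain k l m where *: "\<phi> x = Some (a', k, b)" "\<phi> y = Some (a', l, b)" "\<phi> w = Some (a', m, b)"
      using xyw by (auto simp: H_def)
    have G: "k \<in> carrier G" "l \<in> carrier G" "m \<in> carrier G"
      using phi_coords * HJ xyw by blast+
    have "\<phi> (x * w) = \<phi> (y * w)" using xyw(4) by simp
    moreover have "\<phi> (x * w) = Some (a', k \<otimes> c \<otimes> m, b)" "\<phi> (y * w) = Some (a', l \<otimes> c \<otimes> m, b)"
      using * e HJ xyw(1-3) by (simp_all add: phi_mult)
    ultimately have "k \<otimes> c \<otimes> m = l \<otimes> c \<otimes> m"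
      by simp
    then have "k = l" using G e by simp
    then show ?thesis using * HJ xyw by (intro phi_eqD) auto
  qed
  have "finite H" using assms(2) by (rule rev_finite_subset) (auto simp: H_def)
  have l_inv: "\<exists>y\<in>H. y * x = e" if x: "x \<in> H" for x
  proof -
    \<comment> \<open>Inverses come from finiteness: an injective self-map of \<open>H\<close> is
      onto, so it hits \<open>e\<close>.\<close>
    have "inj_on (\<lambda>y. y * x) H" using cancel x by (auto intro: inj_onI)
    moreover have "(\<lambda>y. y * x) ` H \<subseteq> H" using Hmult x by auto
    ultimately have "(\<lambda>y. y * x) ` H = H"
      using \<open>finite H\<close> by (simp add: endo_inj_surj)
    then show ?thesis using eH by (metis imageE)
  qed
  have "group \<lparr>carrier = H, monoid.mult = (*), one = e\<rparr>"
    by (rule groupI) (use eH Hmult He l_inv in \<open>auto simp: mult.assoc\<close>)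
  moreover have "H \<subseteq> type_II \<inter> J" by (auto simp: H_def)
  ultimately have H: "H = {e}" using ap unfolding aperiodic_def by blast
  have act_e: "act (g, b) e = Some (g, b)"
    using act_J[OF gh(1,2) e(1,6,5)] gh e by (simp add: m_assoc)
  \<comment> \<open>Since \<open>e\<close> fixes \<open>(g, b)\<close>, \<open>e * t\<close> has the
    same effect there as \<open>t\<close>, and it lies in \<open>J\<close>.\<close>
  then have et: "act (g, b) (e * t) = Some (h, b)"
    using t gh by (auto simp: act_mult)
  have etJ: "e * t \<in> J" "e * t \<in> type_II"
    using e t by (auto intro: mult_in_J type_II.mult type_II.idem)
  \<comment> \<open>Absorbing \<open>e\<close> on the left fixes the first coordinate
    \<open>a'\<close> of \<open>e * t\<close>; its effect on \<open>(g, b)\<close> gives the last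
    coordinate \<open>b\<close>.\<close>
  have "e * (e * t) = e * t" using e(2) by (metis mult.assoc)
  then have left: "\<phi> (e * t) = rees_mult G C (\<phi> e) (\<phi> (e * t))"
    using phi_mult[OF e(1) etJ(1)] by simp
  have right: "Some (a, h, b) = rees_mult G C (Some (a, g, b)) (\<phi> (e * t))"
    using et gh phi_mult[of "pt (g, b)" "e * t"] etJ pt_in[of "(g, b)"] phi_pt
    by (auto simp: act_iff)
  obtain a2 k b2 where et_coords: "\<phi> (e * t) = Some (a2, k, b2)"
    using right by (cases "\<phi> (e * t)") auto
  have "a2 = a'" "b2 = b"
    using left[unfolded et_coords e(6)] right[unfolded et_coords]
    by (auto split: option.splits)
  with et_coords have "e * t \<in> H" using etJ by (auto simp: H_def)
  then have "e * t = e" using H by blast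
  then have "Some (h, b) = Some (g, b)" using et act_e by metis
  then show ?thesis by blast
qed

section \<open>Injective congruences and one-point flows\<close>

text \<open>On the R-class, left translation by \<open>h\<close> is left multiplication by an
  element of \<open>J\<close>, which commutes with right multiplication by associativity.\<close>

lemma act_translate:
  assumes h: "h \<in> carrier G" and q: "q \<in> Q" and p: "act q s = Some p"
  shows "act (left_translate G h q) s = Some (left_translate G h p)"
proof -
  obtain b' c where c: "b' \<in> B" "c \<in> carrier G" "C b' a = Some c"
    using sandwich_column q by blast
  \<comment> \<open>The factor \<open>m_inv G c\<close> cancels the entry \<open>c\<close> of
    \<open>C\<close> met in \<open>v * pt x\<close>, leaving \<open>h\<close>.\<close>
  obtain v where v: "v \<in> J" "\<phi> v = Some (a, h \<otimes> m_inv G c, b')"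
    using phi_surj[of a "h \<otimes> m_inv G c" b'] c h a_in by auto
  have T: "left_translate G h x \<in> Q" if "x \<in> Q" for x
    using that h by (auto simp: left_translate_def)
  have vpt: "v * pt x = pt (left_translate G h x)" if x: "x \<in> Q" for x
  proof (rule phi_eqD)
    show "\<phi> (v * pt x) = \<phi> (pt (left_translate G h x))"
      using x T[OF x] v c h pt_in[OF x] phi_pt[OF x]
      by (cases x) (auto simp: phi_mult phi_pt left_translate_def m_assoc)
  qed (use x T v in \<open>auto intro: mult_in_J pt_in\<close>)
  have "p \<in> Q" "pt q * s = pt p" using p unfolding act_iff[OF q] by blast+
  then have "pt (left_translate G h q) * s = pt (left_translate G h p)"
    using vpt q by (metis mult.assoc)
  then show ?thesis using T q \<open>p \<in> Q\<close> by (simp add: act_iff del: mem_Sigma_iff)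
qed

lemma biclosure_translate:
  assumes h: "h \<in> carrier G" and rel: "(q, q') \<in> biclosure Q act"
  shows "(left_translate G h q, left_translate G h q') \<in> biclosure Q act"
proof -
  have "left_translate G h x \<in> Q" if "x \<in> Q" for x
    using that h by (auto simp: left_translate_def)
  then show ?thesis
    using act_translate[OF h] rel by (rule biclosure_equivariant)
qed

text \<open>The single state is sent to all of \<open>Q\<close> partitioned into
  \<open>\<tau>\<close>-classes. The flow condition is then the respect-and-reflect property, and
  invariance follows from equivariance.\<close>

lemma flow_if_cross_section:
  assumes cs: "\<And>g h b. ((g, b), (h, b)) \<in> biclosure Q act \<Longrightarrow> g = h"
  shows "one_point_flow G B act X (\<lambda>_. Some (Q, Q // biclosure Q act))"
proof -
  let ?r = "biclosure Q act"
  have inj: "injective_congruence Q act ?r"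
    by (rule injective_congruence_biclosure)
  note eq = injective_congruenceD(1)[OF inj] and bi = injective_congruenceD(2)[OF inj]
  note block = same_block_quotient[OF eq]
  have T: "left_translate G g x \<in> Q" if "g \<in> carrier G" "x \<in> Q" for g x
    using that by (auto simp: left_translate_def)
  have Tinv: "left_translate G g (left_translate G (m_inv G g) x) = x"
    "left_translate G (m_inv G g) (left_translate G g x) = x"
    if "g \<in> carrier G" "x \<in> Q" for g x
    using that by (auto simp: left_translate_def m_assoc[symmetric])
  have TQ: "left_translate G g ` Q = Q" if g: "g \<in> carrier G" for g
  proof
    show "Q \<subseteq> left_translate G g ` Q"
      using Tinv(1)[OF g] T[of "m_inv G g"] g by (metis imageI inv_closed subsetI)
  qed (use T g in blast)
  have Tclass: "left_translate G g ` (?r `` {q}) = ?r `` {left_translate G g q}"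
    if g: "g \<in> carrier G" and q: "q \<in> Q" for g q
  proof
    show "?r `` {left_translate G g q} \<subseteq> left_translate G g ` (?r `` {q})"
    proof
      fix x assume x: "x \<in> ?r `` {left_translate G g q}"
      then have "x \<in> Q" using biclosure_in by blast
      \<comment> \<open>Translating back by the inverse of \<open>g\<close> turns the inclusion of
        classes into an equality.\<close>
      have "(q, left_translate G (m_inv G g) x) \<in> ?r"
        using biclosure_translate[of "m_inv G g" "left_translate G g q" x] x g q
        by (simp add: Tinv(2)[OF g q])
      then show "x \<in> left_translate G g ` (?r `` {q})"
        using Tinv(1)[OF g \<open>x \<in> Q\<close>] by (metis Image_singleton_iff imageI)
    qed
  qed (use biclosure_translate[OF g] in blast)
  have "image (left_translate G g) ` (Q // ?r) = Q // ?r" if g: "g \<in> carrier G" for g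
  proof -
    have quot: "Q // ?r = (\<lambda>q. ?r `` {q}) ` Q" by (auto simp: quotient_def)
    have "image (left_translate G g) ` (Q // ?r) = (\<lambda>q. ?r `` {left_translate G g q}) ` Q"
      unfolding quot image_image using Tclass[OF g] by (rule image_cong[OF refl])
    also have "\<dots> = (\<lambda>q. ?r `` {q}) ` left_translate G g ` Q"
      by (simp only: image_image)
    finally show ?thesis using TQ[OF g] quot by simp
  qed
  moreover have "partition_on Q (Q // ?r)" using eq by (rule partition_on_quotient)
  moreover have "cross_section Z" if "Z \<in> Q // ?r" for Z
    unfolding cross_section_def using that cs quotient_eq_iff[OF eq that that] by blast
  ultimately have "(Q, Q // ?r) \<in> CS G B"
    using TQ by (auto simp: CS_def SP_def)
  moreover have "flow_step act x (Q, Q // ?r) (Q, Q // ?r)" for x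
    unfolding flow_step_def block prod.case
    using act_closed bi by (intro conjI ballI allI impI) blast+
  ultimately show ?thesis
    by (auto simp: one_point_flow_def flow_def Rh_def)
qed

text \<open>The blocks of the flow are the classes of an injective congruence, which contains
  \<open>\<tau>\<close>, so \<open>\<tau>\<close>-related points share a block, and blocks are
  cross-sections.\<close>

lemma cross_section_if_flow:
  assumes gen: "subsemigroup_generated X = UNIV"
    and flow: "one_point_flow G B act X \<Phi>"
    and rel: "((g, b), (h, b)) \<in> tilson_congruence Q act"
  shows "g = h"
proof -
  obtain Y P where YP: "\<Phi> () = Some (Y, P)" "(Y, P) \<in> CS G B"
    using flow by (auto simp: one_point_flow_def flow_def Rh_def)
  \<comment> \<open>With only one state, completeness makes its set contain every point.\<close>
  have "Y = Q"
  proof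
    show "Y \<subseteq> Q" using YP by (auto simp: CS_def SP_def)
    show "Q \<subseteq> Y" using flow YP(1) by (auto simp: one_point_flow_def flow_def)
  qed
  then have part: "partition_on Q P" using YP by (auto simp: CS_def SP_def)
  have step: "flow_step act x (Q, P) (Q, P)" if "x \<in> X" for x
    using flow YP(1) \<open>Y = Q\<close> that by (auto simp: one_point_flow_def flow_def)
  \<comment> \<open>The flow condition concerns letters only; induction over products extends it to
    the whole semigroup, through the intermediate points.\<close>
  have bi: "\<forall>y\<in>Q. \<forall>y'\<in>Q. \<forall>p p'. act y s = Some p \<and> act y' s = Some p' \<longrightarrow>
        (same_block P y y' \<longleftrightarrow> same_block P p p')" for s
  proof -
    have "s \<in> subsemigroup_generated X" using gen by simp
    then show ?thesis
    proof (induction rule: subsemigroup_generated.induct)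
      case (gen x)
      then show ?case using step[OF gen] by (simp add: flow_step_def del: mem_Sigma_iff)
    next
      case (mult s t)
      show ?case
      proof (intro ballI allI impI, elim conjE)
        fix y y' p p'
        assume Q: "y \<in> Q" "y' \<in> Q" and "act y (s * t) = Some p" "act y' (s * t) = Some p'"
        then obtain m m' where "m \<in> Q" "m' \<in> Q" "act y s = Some m" "act m t = Some p"
          "act y' s = Some m'" "act m' t = Some p'"
          by (auto simp: act_mult)
        then show "same_block P y y' \<longleftrightarrow> same_block P p p'" using mult.IH Q by blast
      qed
    qed
  qed
  let ?r = "{(x, y). \<exists>Z\<in>P. x \<in> Z \<and> y \<in> Z}"
  have "equiv Q ?r" using part by (rule equiv_partition_on)
  then have "injective_congruence Q act ?r"
    unfolding injective_congruence_iff
    using bi by (simp add: same_block_def del: mem_Sigma_iff)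
  then obtain Z where "Z \<in> P" "(g, b) \<in> Z" "(h, b) \<in> Z"
    using rel unfolding tilson_congruence_def by blast
  moreover from this have "cross_section Z" using YP(2) by (auto simp: CS_def)
  ultimately show ?thesis unfolding cross_section_def by blast
qed

end

theorem theorem5p2:
  fixes X J :: "'s::{finite, semigroup_mult} set"
    and G :: "'g monoid"
    and A :: "'a set" and B :: "'b set"
    and C :: "'b \<Rightarrow> 'a \<Rightarrow> 'g option"
    and \<phi> :: "'s \<Rightarrow> ('a \<times> 'g \<times> 'b) option"
    and a :: 'a
    and \<tau> :: "('g \<times> 'b) rel"
  assumes gm: "GM_semigroup J G A B C \<phi>"
    and gen: "subsemigroup_generated X = UNIV"
    and R_class: "a \<in> A"
    and tilson: "\<tau> = tilson_congruence (carrier G \<times> B) (GB_act J G B \<phi> a)"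
  shows "(aperiodic (type_II \<inter> J) \<longleftrightarrow>
            (\<forall>g\<in>carrier G. \<forall>h\<in>carrier G. \<forall>b\<in>B. ((g, b), (h, b)) \<in> \<tau> \<longrightarrow> g = h))
       \<and> ((\<forall>g\<in>carrier G. \<forall>h\<in>carrier G. \<forall>b\<in>B. ((g, b), (h, b)) \<in> \<tau> \<longrightarrow> g = h) \<longleftrightarrow>
            (\<exists>\<Phi>. one_point_flow G B (GB_act J G B \<phi> a) X \<Phi>))"
proof -
  have "two_sided_ideal J"
    using gm unfolding GM_semigroup_def distinguished_ideal_def zero_minimal_ideal_def
      minimal_ideal_def by (auto split: if_splits)
  then interpret rees_R_class G "\<exists>z::'s. is_zero z" J A B C \<phi> a
    using gm R_class unfolding GM_semigroup_def rees_R_class_def rees_R_class_axioms_def by blast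
  have \<tau>: "\<tau> = biclosure Q act"
    unfolding tilson by (rule tilson_congruence_eq_biclosure)
  have inj: "injective_congruence Q act \<tau>"
    unfolding \<tau> by (rule injective_congruence_biclosure)
  let ?cs = "\<forall>g\<in>carrier G. \<forall>h\<in>carrier G. \<forall>b\<in>B. ((g, b), (h, b)) \<in> \<tau> \<longrightarrow> g = h"
  have "aperiodic (type_II \<inter> J)" if ?cs
    by (rule aperiodic_if_cross_section[OF inj]) (use that in blast)
  moreover have ?cs if "aperiodic (type_II \<inter> J)"
    using cross_section_if_aperiodic[OF that] unfolding \<tau> by auto
  moreover have "\<exists>\<Phi>. one_point_flow G B act X \<Phi>" if cs: ?cs
  proof -
    \<comment> \<open>Membership in \<open>carrier G\<close> and \<open>B\<close> is recovered from
      the relation itself.\<close>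
    have "g = h" if "((g, b), (h, b)) \<in> biclosure Q act" for g h b
      using cs biclosure_type_II[OF that] that unfolding \<tau> by auto
    then show ?thesis using flow_if_cross_section by blast
  qed
  moreover have ?cs if "one_point_flow G B act X \<Phi>" for \<Phi>
    using cross_section_if_flow[OF gen that] unfolding tilson by blast
  ultimately show ?thesis by blast
qed

end
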